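(* For any odd prime $p$ and any positive integer $r$, $$\frac1{p^r}\sum_{k=0}^{p^r-1}(3k+1)\frac{(\frac12)_k^3}{(1)_k^3}4^k\equiv\frac1{p}\sum_{k=0}^{p-1}(3k+1)\frac{(\frac12)_k^3}{(1)_k^3}4^k\pmod{p^4}.$$
   Context: $(x)_k=x(x+1)\cdots(x+k-1)$ is the Pochhammer symbol, with $(x)_0=1$. A congruence $a\equiv b\pmod{p^m}$ between rational numbers means that $(a-b)/p^m$ is a rational number whose denominator is not divisible by $p$. *)

theory Defs
  imports Complex_Main "HOL-Computational_Algebra.Primes"
begin

definition rat_cong_mod_prime_pow :: "rat \<Rightarrow> rat \<Rightarrow> nat \<Rightarrow> nat \<Rightarrow> bool" where
  "rat_cong_mod_prime_pow a b p m \<longleftrightarrow>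
     \<not> (int p dvd snd (quotient_of ((a - b) / of_nat (p ^ m))))"

definition S_sum :: "nat \<Rightarrow> rat" where
  "S_sum n = (\<Sum>k<n. (3 * of_nat k + 1) * (pochhammer (1/2) k) ^ 3
                   / (pochhammer 1 k) ^ 3 * 4 ^ k)"

end

(*
Put S(Y) = sum_{k<N} (3k+1) (1/2)_k/k! prod_{i<k} ((2i+1)^2 - Y)/((i+1)^2 - Y), so that
S(0) is the sum in question. A WZ pair shows S(m^2) = m for odd m with N <= m < 2N. After multiplication
by prod_{0<i<N} (i^2 - Y) this is a polynomial of degree less than N whose values are known at the N points
m^2, m odd, m < 2N, and Lagrange interpolation at Y = 0 gives the exact formula
  S(0)/N = sum over odd m < 2N of
    (m/N) prod_{0<i<N} (1 - m^2/i^2) / prod_{j odd, j < 2N, j ~= m} (1 - m^2/j^2).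
Let N = p^r and q = p^(r-1). In closed form the m-th summand is a p-integral multiple of N^2/(m(m+N)), so it
vanishes modulo p^4 unless q divides m. If m = q m', the factors with q | i and q | j make up the m'-th
summand for N = p, because everything is homogeneous in (m, i, j); the remaining factors are 1 modulo p^2.
This suffices because the m'-th summand is itself divisible by p^2, except for m' = p, where the
remaining factors are even 1 modulo p^4.
*)
theory Submission
  imports Defs "HOL-Computational_Algebra.Polynomial"
begin

section \<open>WZ evaluation of the deformed sum at the square of an odd number\<close>

section \<open>A WZ identity\<close>

text \<open>With \<open>m = 2 * h + 1\<close> and \<open>k \<le> h\<close>,
  \<open>(3 * k + 1) * wz h k\<close> is the k-th term of S(m^2), divided by m. For
  \<open>k > h\<close> the subtraction \<open>h - k\<close> truncates and the value is meaningless,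
  so sums of \<open>wz h\<close> stop at h.\<close>

definition wz :: "nat \<Rightarrow> nat \<Rightarrow> rat" where
  "wz h k = of_nat (2 * k choose k) * fact (h + k) * fact (2 * h - k) / (fact (h - k) * fact (2 * h + 1 + k))"

lemma central_binomial_Suc:
  "of_nat (2 * Suc n choose Suc n) = (2 * (2 * of_nat n + 1) / (of_nat n + 1) * of_nat (2 * n choose n) :: rat)"
proof -
  have fact: "of_nat (2 * k choose k) = (fact (2 * k) / (fact k * fact k) :: rat)" for k
    using binomial_fact[of k "2 * k", where ?'a = rat] by simp
  have "of_nat (2 * Suc n choose Suc n) = (fact (2 * Suc n) / (fact (Suc n) * fact (Suc n)) :: rat)"
    by (rule fact)
  also have "\<dots> = 2 * (2 * of_nat n + 1) / (of_nat n + 1) * (fact (2 * n) / (fact n * fact n))"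
  proof -
    define F G x :: rat where "F = fact n" and "G = fact (2 * n)" and "x = of_nat n"
    have nz: "F \<noteq> 0" "x + 1 \<noteq> 0" by (simp_all add: F_def x_def add_eq_0_iff_both_eq_0)
    have f: "fact (2 * Suc n) = 2 * (x + 1) * (2 * x + 1) * G"
      unfolding mult_Suc_right add_2_eq_Suc fact_Suc of_nat_Suc of_nat_mult of_nat_numeral G_def x_def by algebra
    have g: "fact (Suc n) = (x + 1) * F" by (simp add: F_def x_def)
    show ?thesis unfolding f g F_def[symmetric] G_def[symmetric] x_def[symmetric]
      using nz by (simp add: divide_simps) (simp add: algebra_simps)
  qed
  finally show ?thesis unfolding fact[of n] .
qed

text \<open>The WZ companion of \<open>(3 k + 1) * wz h k\<close>, found by Gosper summation of its difference in \<open>h\<close>.\<close>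

definition wz_cert :: "nat \<Rightarrow> nat \<Rightarrow> rat" where
  "wz_cert h n = of_nat (2 * n choose n) * fact (h + n) * fact (2 * h - n) / (fact (h + 1 - n) * fact (2 * h + 3 + n))
     * (of_nat n)\<^sup>2 * (2 * (of_nat n)\<^sup>2 + 4 * of_nat n - 8 * (of_nat h)\<^sup>2 - 16 * of_nat h - 6)"

text \<open>After division by a common factor \<open>B\<close> all four terms are polynomials in n
  and \<open>h - n\<close>, which leaves a single polynomial identity. The bound
  \<open>h \<ge> 1\<close> keeps \<open>2 * h - Suc n\<close> from being truncated.\<close>

lemma wz_step:
  assumes "n \<le> h" "h \<ge> 1"
  shows "wz_cert h n + (3 * of_nat n + 1) * (wz (Suc h) n - wz h n) = wz_cert h (Suc n)"
proof -
  obtain j where h: "h = n + j" using assms le_Suc_ex by blast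
  obtain q where q: "n + 2 * j = Suc q" using assms h by (cases "n + 2 * j") auto
  \<comment> \<open>\<open>B\<close> takes the smallest factorials of the four numerators and the
    largest of the four denominators.\<close>
  define B :: rat where "B = of_nat (2 * n choose n) * fact (2 * n + j) * fact q / (fact (Suc j) * fact (3 * n + 2 * j + 4))"
  define x y :: rat where "x = of_nat n" and "y = of_nat j"
  have nn: "x \<ge> 0" "y \<ge> 0" by (simp_all add: x_def y_def)
  have [simp]: "x + 1 \<noteq> 0" "y + 1 \<noteq> 0" "3 * x + 2 * y + 2 \<noteq> 0" "3 * x + 2 * y + 3 \<noteq> 0" "3 * x + 2 * y + 4 \<noteq> 0"
    using nn by linarith+
  have fq: "fact (n + 2 * j) = (x + 2 * y) * (fact q :: rat)"
  proof -
    have "x + 2 * y = of_nat (Suc q)" unfolding q[symmetric] x_def y_def by simp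
    then show ?thesis unfolding q by simp
  qed
  have f3: "fact (3 * n + 2 * j + 4) = (3*x+2*y+4) * (3*x+2*y+3) * (3*x+2*y+2) * (fact (3 * n + 2 * j + 1) :: rat)"
    "fact (3 * n + 2 * j + 3) = (3*x+2*y+3) * (3*x+2*y+2) * (fact (3 * n + 2 * j + 1) :: rat)"
  proof -
    define t where "t = 3 * n + 2 * j + 1"
    have t: "of_nat t = 3*x + 2*y + 1" by (simp add: t_def x_def y_def)
    have e: "3 * n + 2 * j + 4 = Suc (Suc (Suc t))" "3 * n + 2 * j + 3 = Suc (Suc t)" by (simp_all add: t_def)
    show "fact (3 * n + 2 * j + 4) = (3*x+2*y+4) * (3*x+2*y+3) * (3*x+2*y+2) * (fact (3 * n + 2 * j + 1) :: rat)"
      "fact (3 * n + 2 * j + 3) = (3*x+2*y+3) * (3*x+2*y+2) * (fact (3 * n + 2 * j + 1) :: rat)"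
      unfolding e fact_Suc of_nat_Suc t t_def[symmetric] by algebra+
  qed
  have fj: "fact (Suc j) = (y + 1) * (fact j :: rat)" "fact (Suc (2*n+j)) = (2*x+y+1) * (fact (2*n+j) :: rat)"
    "fact (Suc (Suc (n + 2 * j))) = (x + 2 * y + 2) * (x + 2 * y + 1) * (fact (n + 2 * j) :: rat)"
    unfolding fact_Suc of_nat_Suc of_nat_add of_nat_mult x_def y_def of_nat_numeral by algebra+
  have cross: "b \<noteq> 0 \<Longrightarrow> d \<noteq> 0 \<Longrightarrow> a * d = c * e * b \<Longrightarrow> a / b = c / d * e" for a b c d e :: rat
    by (simp add: field_simps)
  have F0: "wz h n = B * ((x+2*y)*(y+1)*(3*x+2*y+2)*(3*x+2*y+3)*(3*x+2*y+4))"
  proof -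
    have e: "h + n = 2 * n + j" "2 * h - n = n + 2 * j" "h - n = j" "2 * h + 1 + n = 3 * n + 2 * j + 1"
      using h by auto
    show ?thesis unfolding wz_def e B_def f3 fj fq by (intro cross) (simp, simp, simp only: mult_ac)
  qed
  have F1: "wz (Suc h) n = B * ((2*x+y+1)*(x+2*y)*(x+2*y+1)*(x+2*y+2)*(3*x+2*y+4))"
  proof -
    have e: "Suc h + n = Suc (2 * n + j)" "2 * Suc h - n = Suc (Suc (n + 2 * j))" "Suc h - n = Suc j"
         "2 * Suc h + 1 + n = 3 * n + 2 * j + 3"
      using h by auto
    show ?thesis unfolding wz_def e B_def f3 fj fq by (intro cross) (simp, simp, simp only: mult_ac)
  qed
  have hx: "of_nat h = x + y" by (simp add: h x_def y_def)
  have G0: "wz_cert h n = B * ((x+2*y)*(3*x+2*y+4)) * x\<^sup>2 * (2*x\<^sup>2 + 4*x - 8*(x+y)\<^sup>2 - 16*(x+y) - 6)"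
  proof -
    have e: "h + n = 2 * n + j" "2 * h - n = n + 2 * j" "h + 1 - n = Suc j" "2 * h + 3 + n = 3 * n + 2 * j + 3"
      using h by auto
    show ?thesis unfolding wz_cert_def e B_def f3 fj fq hx x_def[symmetric]
      by (rule arg_cong2[of _ _ _ _ "(*)"], rule arg_cong2[of _ _ _ _ "(*)"], rule cross) (simp, simp, simp only: mult_ac, rule refl, rule refl)
  qed
  have G1: "wz_cert h (Suc n) = B * (2*(2*x+1)*(2*x+y+1)*(y+1)) * (x+1) * (2*(x+1)\<^sup>2 + 4*(x+1) - 8*(x+y)\<^sup>2 - 16*(x+y) - 6)"
  proof -
    have e: "h + Suc n = Suc (2 * n + j)" "2 * h - Suc n = q" "h + 1 - Suc n = j" "2 * h + 3 + Suc n = 3 * n + 2 * j + 4"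
      using h q by auto
    have S: "of_nat (Suc n) = x + 1" by (simp add: x_def)
    \<comment> \<open>This denominator comes from the next central binomial coefficient; it cancels
      one factor of \<open>(x + 1)\<^sup>2\<close> in the certificate.\<close>
    define i where "i = inverse (x + 1)"
    have i: "i * (x + 1)\<^sup>2 = x + 1" by (simp add: i_def power2_eq_square)
    have C: "of_nat (2 * Suc n choose Suc n) = 2 * (2*x+1) * i * of_nat (2 * n choose n)"
      unfolding central_binomial_Suc x_def i_def by (simp only: divide_inverse mult_ac)
    have "wz_cert h (Suc n) = B * (2*(2*x+1)*i*(2*x+y+1)*(y+1)) * (x+1)\<^sup>2 * (2*(x+1)\<^sup>2 + 4*(x+1) - 8*(x+y)\<^sup>2 - 16*(x+y) - 6)"
      unfolding wz_cert_def B_def hx C S e f3 fj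
      by (rule arg_cong2[of _ _ _ _ "(*)"], rule arg_cong2[of _ _ _ _ "(*)"], rule cross) (simp, simp, simp only: mult_ac, rule refl, rule refl)
    also have "B * (2*(2*x+1)*i*(2*x+y+1)*(y+1)) * (x+1)\<^sup>2 = B * (2*(2*x+1)*(2*x+y+1)*(y+1)) * (i * (x+1)\<^sup>2)"
      by (simp only: mult_ac)
    finally show ?thesis unfolding i .
  qed
  have "((x+2*y)*(3*x+2*y+4)) * x\<^sup>2 * (2*x\<^sup>2 + 4*x - 8*(x+y)\<^sup>2 - 16*(x+y) - 6) + (3*x+1) *
    (((2*x+y+1)*(x+2*y)*(x+2*y+1)*(x+2*y+2)*(3*x+2*y+4)) - ((x+2*y)*(y+1)*(3*x+2*y+2)*(3*x+2*y+3)*(3*x+2*y+4)))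
    = (2*(2*x+1)*(2*x+y+1)*(y+1)) * (x+1) * (2*(x+1)\<^sup>2 + 4*(x+1) - 8*(x+y)\<^sup>2 - 16*(x+y) - 6)"
    by algebra
  moreover have "a * b * c + d * (u - v) = e * f * g \<Longrightarrow> B * a * b * c + d * (B * u - B * v) = B * e * f * g"
    for a b c d e f g u v :: rat
    by algebra
  ultimately show ?thesis unfolding F0 F1 G0 G1 x_def[symmetric] by blast
qed

text \<open>Induction on h: the difference of two consecutive sums telescopes through
  \<open>wz_cert\<close>, which is 0 at \<open>n = 0\<close>.\<close>

lemma sum_wz_eq_1: "(\<Sum>k\<le>h. (3 * of_nat k + 1) * wz h k) = 1"
proof (induction h)
  case 0
  show ?case by (simp add: wz_def)
next
  case (Suc h)
  show ?case
  \<comment> \<open>\<open>wz_step\<close> needs \<open>h \<ge> 1\<close>, so the passage from 0 to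
    1 is a direct computation.\<close>
  proof (cases "h = 0")
    case True
    then show ?thesis by (simp add: wz_def numeral_eq_Suc)
  next
    case False
    have "n \<le> Suc h \<Longrightarrow> (\<Sum>k<n. (3 * of_nat k + 1) * (wz (Suc h) k - wz h k)) = wz_cert h n" for n
    proof (induction n)
      case 0
      then show ?case by (simp add: wz_cert_def)
    next
      case (Suc n)
      then show ?case using wz_step[of n h] False by simp
    qed
    from this[of "Suc h"] have "(\<Sum>k\<le>h. (3 * of_nat k + 1) * wz (Suc h) k) = wz_cert h (Suc h) + 1"
      using Suc by (simp add: lessThan_Suc_atMost algebra_simps sum_subtractf sum.distrib)
    \<comment> \<open>The term at \<open>k = Suc h\<close>, present only in the longer sum, cancels
      the boundary value of the telescoping.\<close>
    moreover have "wz_cert h (Suc h) + (3 * of_nat (Suc h) + 1) * wz (Suc h) (Suc h) = 0"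
    proof -
      obtain g where g: "h = Suc g" using False by (cases h) auto
      have e: "h + Suc h = 2 * g + 3" "2 * h - Suc h = g" "h + 1 - Suc h = 0" "2 * h + 3 + Suc h = 3 * g + 7"
        "Suc h + Suc h = Suc (2 * g + 3)" "2 * Suc h - Suc h = Suc (Suc g)" "Suc h - Suc h = 0" "2 * Suc h + 1 + Suc h = 3 * g + 7"
        using g by auto
      define x :: rat where "x = of_nat g"
      define E :: rat where "E = of_nat (2 * Suc h choose Suc h) * fact (2 * g + 3) * fact g / fact (3 * g + 7)"
      have f: "fact (Suc (2 * g + 3)) = (2*x+4) * (fact (2 * g + 3) :: rat)"
        "fact (Suc (Suc g)) = (x+2) * (x+1) * (fact g :: rat)"
        unfolding fact_Suc of_nat_Suc of_nat_add of_nat_mult x_def of_nat_numeral by algebra+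
      have hx: "of_nat (Suc h) = x + 2" "of_nat h = x + 1" by (simp_all add: g x_def)
      have "wz (Suc h) (Suc h) = E * ((2*x+4)*(x+2)*(x+1))"
        unfolding wz_def e f E_def by simp
      moreover have "wz_cert h (Suc h) = E * (x+2)\<^sup>2 * (2*(x+2)\<^sup>2 + 4*(x+2) - 8*(x+1)\<^sup>2 - 16*(x+1) - 6)"
        unfolding wz_cert_def e f E_def hx by simp
      ultimately show ?thesis unfolding hx by algebra
    qed
    ultimately show ?thesis by simp
  qed
qed

section \<open>Lagrange interpolation over a field, with indexed nodes\<close>

section \<open>Lagrange interpolation\<close>

text \<open>The interpolant \<open>Q\<close> agrees with \<open>P\<close> at \<open>card I\<close>
  distinct nodes \<open>f i\<close>, and both have degree below \<open>card I\<close>, hence they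
  coincide.\<close>

lemma lagrange_interpolation:
  fixes f :: "'b \<Rightarrow> 'a :: field" and P :: "'a poly"
  assumes fin: "finite I" and inj: "inj_on f I" and deg: "degree P < card I"
  shows "poly P x = (\<Sum>i\<in>I. poly P (f i) * (\<Prod>j\<in>I-{i}. (x - f j) / (f i - f j)))"
proof -
  \<comment> \<open>The Lagrange basis: \<open>L i\<close> is 1 at the node \<open>f i\<close> and 0
    at the other nodes.\<close>
  define L where "L i = (\<Prod>j\<in>I-{i}. smult (1 / (f i - f j)) [:- f j, 1:])" for i
  define Q where "Q = (\<Sum>i\<in>I. smult (poly P (f i)) (L i))"
  have polyL: "poly (L i) x = (\<Prod>j\<in>I-{i}. (x - f j) / (f i - f j))" for i x
    unfolding L_def poly_prod by (intro prod.cong) (auto simp: diff_divide_distrib)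
  have Lf: "poly (L i) (f k) = (if i = k then 1 else 0)" if "i \<in> I" "k \<in> I" for i k
  proof (cases "i = k")
    case True
    have "f k \<noteq> f j" if "j \<in> I - {k}" for j using inj that \<open>k \<in> I\<close> by (auto dest: inj_onD)
    then show ?thesis unfolding polyL using True by (auto intro!: prod.neutral)
  next
    case False
    then show ?thesis unfolding polyL using that fin by (auto intro!: prod_zero)
  qed
  have eq: "poly Q (f k) = poly P (f k)" if "k \<in> I" for k
  proof -
    have "poly Q (f k) = (\<Sum>i\<in>I. if i = k then poly P (f i) else 0)"
      unfolding Q_def poly_sum using that by (intro sum.cong) (simp_all add: Lf)
    then show ?thesis using that fin by simp
  qed
  have "degree (L i) \<le> card I - 1" if "i \<in> I" for i
  proof -
    have "degree (L i) \<le> (\<Sum>j\<in>I-{i}. degree (smult (1 / (f i - f j)) [:- f j, 1:]))"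
      unfolding L_def using fin by (intro degree_prod_sum_le[THEN order_trans]) (auto simp: o_def)
    also have "\<dots> \<le> (\<Sum>j\<in>I-{i}. 1)" by (intro sum_mono) (auto intro: degree_smult_le[THEN order_trans])
    finally show ?thesis using that fin by simp
  qed
  then have "degree Q \<le> card I - 1"
    unfolding Q_def using fin by (intro degree_sum_le) (auto intro: degree_smult_le[THEN order_trans])
  then have "degree Q < card I" using deg by linarith
  then have "P = Q" using deg eq card_image[OF inj]
    by (intro poly_eqI_degree[where A = "f ` I"]) auto
  then have "poly P x = poly Q x" by simp
  then show ?thesis unfolding Q_def poly_sum by (simp add: polyL)
qed

section \<open>Values of the cleared deformed sum at odd squares, and its interpolation at 0\<close>

section \<open>The deformed sum as a polynomial\<close>

text \<open>The squares of these N numbers are the interpolation nodes, just enough for degree at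
  most \<open>N - 1\<close>.\<close>

definition odds :: "nat \<Rightarrow> nat set" where "odds N = {m. odd m \<and> m < 2 * N}"

lemma odds_eq_image: "odds N = (\<lambda>l. 2 * l + 1) ` {..<N}"
  unfolding odds_def by (auto elim!: oddE)

lemma finite_odds [simp]: "finite (odds N)" by (simp add: odds_eq_image)

lemma card_odds [simp]: "card (odds N) = N"
  unfolding odds_eq_image by (subst card_image) (auto simp: inj_on_def)

text \<open>Two of the three factors \<open>(1/2)\<^sub>k / (1)\<^sub>k\<close> are deformed by \<open>Y\<close> and the denominators cleared;
  \<open>Y = 0\<close> gives back \<open>S_sum N\<close>.\<close>

definition trunc_poly :: "nat \<Rightarrow> rat poly" where
  "trunc_poly N = (\<Sum>k<N. smult ((3 * of_nat k + 1) * pochhammer (1/2) k / fact k)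
     ((\<Prod>i<k. [:(of_nat (2 * i + 1))\<^sup>2, -1:]) * (\<Prod>i\<in>{k+1..<N}. [:(of_nat i)\<^sup>2, -1:])))"

lemma poly_trunc_poly:
  "poly (trunc_poly N) y = (\<Sum>k<N. (3 * of_nat k + 1) * pochhammer (1/2) k / fact k *
     ((\<Prod>i<k. (of_nat (2 * i + 1))\<^sup>2 - y) * (\<Prod>i\<in>{k+1..<N}. (of_nat i)\<^sup>2 - y)))"
  by (simp add: trunc_poly_def poly_sum poly_prod)

lemma degree_prod_linear_le:
  fixes c :: "nat \<Rightarrow> rat"
  assumes "finite A" shows "degree (\<Prod>i\<in>A. [:c i, -1:]) \<le> card A"
proof -
  have "degree (\<Prod>i\<in>A. [:c i, -1:]) \<le> (\<Sum>i\<in>A. degree [:c i, -1:])"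
    using degree_prod_sum_le[OF assms, of "\<lambda>i. [:c i, -1:]"] by (simp add: o_def)
  then show ?thesis by simp
qed

text \<open>The k-th summand has k linear factors from its numerator and \<open>N - 1 - k\<close>
  from clearing denominators.\<close>

lemma degree_trunc_poly: "degree (trunc_poly N) \<le> N - 1"
proof -
  have "degree ((\<Prod>i<k. [:(of_nat (2 * i + 1))\<^sup>2, -1:]) * (\<Prod>i\<in>{k+1..<N}. [:(of_nat i)\<^sup>2, -1 :: rat:])) \<le> N - 1"
    if "k < N" for k
  proof -
    have "degree (\<Prod>i<k. [:(of_nat (2 * i + 1))\<^sup>2, -1 :: rat:]) \<le> k"
      "degree (\<Prod>i\<in>{k+1..<N}. [:(of_nat i)\<^sup>2, -1 :: rat:]) \<le> N - (k + 1)"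
      using degree_prod_linear_le[of "{..<k}"] degree_prod_linear_le[of "{k+1..<N}"] by simp_all
    with that show ?thesis by (intro degree_mult_le[THEN order_trans]) linarith
  qed
  then show ?thesis unfolding trunc_poly_def
    by (intro degree_sum_le) (auto intro: degree_smult_le[THEN order_trans])
qed

text \<open>The term ratio in k, used to identify \<open>wz\<close> with the terms of the deformed
  sum by induction.\<close>

lemma wz_Suc:
  assumes "k < h"
  shows "wz h (Suc k) = wz h k * (2 * (2 * of_nat k + 1) / (of_nat k + 1) *
    ((of_nat h + of_nat k + 1) * (of_nat h - of_nat k)) / ((2 * of_nat h - of_nat k) * (2 * of_nat h + 2 + of_nat k)))"
proof -
  define a b :: rat where "a = of_nat k" and "b = of_nat h"
  have ab: "a \<ge> 0" "a < b" using assms by (simp_all add: a_def b_def)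
  obtain j where j: "h = Suc (k + j)" using assms less_iff_Suc_add by auto
  have bj: "of_nat j = b - a - 1" by (simp add: b_def a_def j)
  have e: "h + Suc k = Suc (h + k)" "2 * h - Suc k = k + 2 * j + 1" "2 * h - k = Suc (k + 2 * j + 1)"
    "h - Suc k = j" "h - k = Suc j" "2 * h + 1 + Suc k = Suc (2 * h + 1 + k)" using j by auto
  define A B C D :: rat where "A = fact (h + k)" and "B = fact (k + 2 * j + 1)" and "C = fact j" and "D = fact (2 * h + 1 + k)"
  have f: "fact (Suc (h + k)) = (b + a + 1) * A" "fact (Suc (k + 2 * j + 1)) = (2 * b - a) * B"
    "fact (Suc j) = (b - a) * C" "fact (Suc (2 * h + 1 + k)) = (2 * b + 2 + a) * D"
    unfolding fact_Suc of_nat_Suc of_nat_add of_nat_mult of_nat_1 of_nat_numeral bj A_def B_def C_def D_def a_def[symmetric] b_def[symmetric]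
    by algebra+
  have nz: "C \<noteq> 0" "D \<noteq> 0" "a + 1 \<noteq> 0" "b - a \<noteq> 0" "2 * b - a \<noteq> 0" "2 * b + 2 + a \<noteq> 0"
    using ab by (simp_all add: C_def D_def)
  show ?thesis
    unfolding wz_def central_binomial_Suc e f A_def[symmetric] B_def[symmetric] C_def[symmetric] D_def[symmetric]
      a_def[symmetric] b_def[symmetric]
    using nz by (simp add: divide_simps)
qed

text \<open>Both sides agree at \<open>k = 0\<close>, where \<open>wz h 0 = 1 / m\<close>, and have
  equal term ratios because (2k+1)^2 - m^2 = -4(h-k)(h+k+1) and (k+1)^2 - m^2 =
  -(2h-k)(2h+2+k).\<close>

lemma poch_prod_eq_wz:
  assumes "k \<le> h" and m: "m = 2 * h + 1"
  shows "pochhammer (1/2) k / fact k * (\<Prod>i<k. (of_nat (2 * i + 1))\<^sup>2 - (of_nat m)\<^sup>2)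
    = (\<Prod>i\<in>{1..k}. (of_nat i)\<^sup>2 - (of_nat m)\<^sup>2) * of_nat m * (wz h k :: rat)"
  using assms(1)
proof (induction k)
  case 0
  have "of_nat m \<noteq> (0 :: rat)" unfolding m of_nat_eq_0_iff by simp
  then show ?case by (simp add: wz_def m)
next
  case (Suc k)
  define a b :: rat where "a = of_nat k" and "b = of_nat h"
  have "k < h" using Suc by simp
  then have ab: "a \<ge> 0" "a < b" by (simp_all add: a_def b_def)
  define c where "c = pochhammer (1/2 :: rat) k / fact k"
  define U where "U = (\<Prod>i<k. (of_nat (2 * i + 1))\<^sup>2 - (of_nat m :: rat)\<^sup>2)"
  define D where "D = (\<Prod>i\<in>{1..k}. (of_nat i)\<^sup>2 - (of_nat m :: rat)\<^sup>2)"
  have IH: "c * U = D * of_nat m * wz h k" using Suc by (simp add: c_def U_def D_def)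
  have c1: "pochhammer (1/2 :: rat) (Suc k) / fact (Suc k) = c * ((2 * a + 1) / (2 * (a + 1)))"
    using ab by (simp add: c_def pochhammer_Suc a_def divide_simps) (simp add: algebra_simps)
  have U1: "(\<Prod>i<Suc k. (of_nat (2 * i + 1))\<^sup>2 - (of_nat m :: rat)\<^sup>2) = U * (-4 * ((b - a) * (b + a + 1)))"
    by (simp add: U_def m a_def b_def power2_eq_square algebra_simps)
  have D1: "(\<Prod>i\<in>{1..Suc k}. (of_nat i)\<^sup>2 - (of_nat m :: rat)\<^sup>2) = D * (- ((2 * b - a) * (2 * b + 2 + a)))"
    by (simp add: D_def m a_def b_def power2_eq_square algebra_simps)
  have nz: "a + 1 \<noteq> 0" "2 * b - a \<noteq> 0" "2 * b + 2 + a \<noteq> 0" using ab by simp_all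
  have "c * ((2 * a + 1) / (2 * (a + 1))) * (U * (-4 * ((b - a) * (b + a + 1))))
    = (c * U) * ((2 * a + 1) / (2 * (a + 1)) * (-4 * ((b - a) * (b + a + 1))))" by simp
  also have "\<dots> = D * of_nat m * wz h k * ((2 * a + 1) / (2 * (a + 1)) * (-4 * ((b - a) * (b + a + 1))))"
    unfolding IH ..
  also have "(2 * a + 1) / (2 * (a + 1)) * (-4 * ((b - a) * (b + a + 1)))
    = (- ((2 * b - a) * (2 * b + 2 + a))) * (2 * (2 * a + 1) / (a + 1) * ((b + a + 1) * (b - a)) / ((2 * b - a) * (2 * b + 2 + a)))"
    using nz by (simp add: divide_simps) algebra
  finally show ?case
    unfolding c1 U1 D1 wz_Suc[OF \<open>k < h\<close>] a_def[symmetric] b_def[symmetric] by (simp only: mult_ac)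
qed

text \<open>For \<open>m \<ge> N\<close> this is the WZ evaluation S(m^2) = m with denominators
  cleared; for \<open>m < N\<close> both sides vanish.\<close>

lemma poly_trunc_poly_odd:
  assumes m: "m \<in> odds N"
  shows "poly (trunc_poly N) ((of_nat m)\<^sup>2) = of_nat m * (\<Prod>i\<in>{1..<N}. (of_nat i)\<^sup>2 - (of_nat m)\<^sup>2)"
proof (cases "m < N")
  case True
  have "m \<ge> 1" using m by (auto simp: odds_def elim!: oddE)
  then have z: "(\<Prod>i\<in>{1..<N}. (of_nat i)\<^sup>2 - (of_nat m :: rat)\<^sup>2) = 0"
    using True by (intro prod_zero) auto
  \<comment> \<open>If \<open>k < m\<close>, the factor \<open>i = m\<close> of the second product
    is 0; otherwise \<open>h < m \<le> k\<close>, and the factor \<open>i = h\<close> of the first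
    one is 0.\<close>
  have "(\<Prod>i<k. (of_nat (2 * i + 1))\<^sup>2 - (of_nat m :: rat)\<^sup>2) * (\<Prod>i\<in>{k+1..<N}. (of_nat i)\<^sup>2 - (of_nat m :: rat)\<^sup>2) = 0" for k
  proof (cases "k < m")
    case True
    then have "(\<Prod>i\<in>{k+1..<N}. (of_nat i)\<^sup>2 - (of_nat m :: rat)\<^sup>2) = 0"
      using \<open>m < N\<close> by (intro prod_zero) (auto intro!: bexI[of _ m])
    then show ?thesis by simp
  next
    case False
    obtain h where h: "m = 2 * h + 1" using m by (auto simp: odds_def elim!: oddE)
    have "(\<Prod>i<k. (of_nat (2 * i + 1))\<^sup>2 - (of_nat m :: rat)\<^sup>2) = 0"
      using False h by (intro prod_zero) (auto intro!: bexI[of _ h])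
    then show ?thesis by simp
  qed
  then have "poly (trunc_poly N) ((of_nat m)\<^sup>2) = 0"
    unfolding poly_trunc_poly by (intro sum.neutral) simp
  then show ?thesis using z by simp
next
  case False
  obtain h where h: "m = 2 * h + 1" using m by (auto simp: odds_def elim!: oddE)
  have hN: "h < N" using m h by (simp add: odds_def)
  define D where "D = (\<Prod>i\<in>{1..<N}. (of_nat i)\<^sup>2 - (of_nat m :: rat)\<^sup>2)"
  define T where "T k = (3 * of_nat k + 1) * pochhammer (1/2) k / fact k *
     ((\<Prod>i<k. (of_nat (2 * i + 1))\<^sup>2 - (of_nat m)\<^sup>2) * (\<Prod>i\<in>{k+1..<N}. (of_nat i)\<^sup>2 - (of_nat m :: rat)\<^sup>2))" for k
  have T0: "T k = 0" if "k > h" for k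
  proof -
    have "(\<Prod>i<k. (of_nat (2 * i + 1))\<^sup>2 - (of_nat m :: rat)\<^sup>2) = 0"
      using that h by (intro prod_zero) (auto intro!: bexI[of _ h])
    then show ?thesis by (simp add: T_def)
  qed
  have T1: "T k = of_nat m * D * ((3 * of_nat k + 1) * wz h k)" if "k \<le> h" for k
  proof -
    have "{1..<N} = {1..k} \<union> {k+1..<N}" "{1..k} \<inter> {k+1..<N} = {}" using that hN by auto
    then have "D = (\<Prod>i\<in>{1..k}. (of_nat i)\<^sup>2 - (of_nat m)\<^sup>2) * (\<Prod>i\<in>{k+1..<N}. (of_nat i)\<^sup>2 - (of_nat m)\<^sup>2)"
      unfolding D_def by (metis prod.union_disjoint finite_atLeastAtMost finite_atLeastLessThan)
    moreover have "T k = (3 * of_nat k + 1) * (pochhammer (1/2) k / fact k * (\<Prod>i<k. (of_nat (2 * i + 1))\<^sup>2 - (of_nat m)\<^sup>2))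
      * (\<Prod>i\<in>{k+1..<N}. (of_nat i)\<^sup>2 - (of_nat m)\<^sup>2)"
      by (simp add: T_def)
    ultimately show ?thesis unfolding poch_prod_eq_wz[OF that h] by (simp only: mult_ac)
  qed
  have "poly (trunc_poly N) ((of_nat m)\<^sup>2) = (\<Sum>k<N. T k)" by (simp add: poly_trunc_poly T_def)
  \<comment> \<open>The terms beyond h vanish, and \<open>h < N\<close> ensures that none up to h is
    cut off.\<close>
  also have "\<dots> = (\<Sum>k\<le>h. T k)"
    by (rule sum.mono_neutral_right) (use hN T0 in auto)
  also have "\<dots> = (\<Sum>k\<le>h. of_nat m * D * ((3 * of_nat k + 1) * wz h k))"
    by (intro sum.cong refl T1) simp
  also have "\<dots> = of_nat m * D"
    unfolding sum_distrib_left[symmetric] sum_wz_eq_1 by simp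
  finally show ?thesis by (simp add: D_def)
qed

text \<open>At 0 the product of the (2i+1)^2 is \<open>4 ^ k\<close> times the square of the
  Pochhammer symbol, and the squares up to k missing from the second product supply
  \<open>(fact k)\<^sup>2\<close>.\<close>

lemma poly_trunc_poly_0: "poly (trunc_poly N) 0 = S_sum N * (\<Prod>i\<in>{1..<N}. (of_nat i)\<^sup>2)"
  unfolding poly_trunc_poly S_sum_def sum_distrib_right
proof (intro sum.cong refl)
  fix k assume "k \<in> {..<N}"
  then have k: "k < N" by simp
  have "{1..<N} = {1..k} \<union> {k+1..<N}" "{1..k} \<inter> {k+1..<N} = {}" using k by auto
  then have "(\<Prod>i\<in>{1..<N}. (of_nat i)\<^sup>2) = (\<Prod>i\<in>{1..k}. (of_nat i)\<^sup>2) * (\<Prod>i\<in>{k+1..<N}. (of_nat i :: rat)\<^sup>2)"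
    by (metis prod.union_disjoint finite_atLeastAtMost finite_atLeastLessThan)
  moreover have "(\<Prod>i\<in>{1..k}. (of_nat i :: rat)\<^sup>2) = (fact k)\<^sup>2"
    by (simp add: fact_prod prod_power_distrib)
  moreover have "(\<Prod>i<k. (of_nat (2 * i + 1) :: rat)\<^sup>2) = 4 ^ k * (pochhammer (1/2) k)\<^sup>2"
    by (induction k) (simp_all add: pochhammer_Suc power2_eq_square field_simps)
  ultimately show "(3 * of_nat k + 1) * pochhammer (1/2) k / fact k *
      ((\<Prod>i<k. (of_nat (2 * i + 1))\<^sup>2 - 0) * (\<Prod>i\<in>{k+1..<N}. (of_nat i)\<^sup>2 - 0)) =
    (3 * of_nat k + 1) * pochhammer (1/2) k ^ 3 / pochhammer 1 k ^ 3 * 4 ^ k * (\<Prod>i\<in>{1..<N}. (of_nat i)\<^sup>2 :: rat)"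
    by (simp add: pochhammer_fact[symmetric] field_simps power2_eq_square power3_eq_cube)
qed

text \<open>The m-th Lagrange term at 0, divided by N times the product of the
  \<open>i\<^sup>2\<close>. Only ratios occur, so a common factor of m, N, i and j cancels.\<close>

definition weight :: "nat \<Rightarrow> nat \<Rightarrow> rat" where
  "weight N m = of_nat m / of_nat N * (\<Prod>i\<in>{1..<N}. 1 - (of_nat m / of_nat i)\<^sup>2)
     / (\<Prod>j\<in>odds N - {m}. 1 - (of_nat m / of_nat j)\<^sup>2)"

text \<open>Interpolation of \<open>trunc_poly N\<close> at 0 from its values at the odd
  squares.\<close>

lemma S_sum_eq_sum_weight:
  assumes "N > 0"
  shows "S_sum N / of_nat N = (\<Sum>m\<in>odds N. weight N m)"
proof -
  define F where "F = (\<Prod>i\<in>{1..<N}. (of_nat i :: rat)\<^sup>2)"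
  have F: "F \<noteq> 0" unfolding F_def by (subst prod_zero_iff) auto
  have "inj_on (\<lambda>m. (of_nat m :: rat)\<^sup>2) (odds N)"
    by (intro inj_onI) (simp add: power2_eq_iff_nonneg)
  moreover have "degree (trunc_poly N) < card (odds N)"
    using degree_trunc_poly[of N] assms by simp
  ultimately have "poly (trunc_poly N) 0 = (\<Sum>m\<in>odds N. poly (trunc_poly N) ((of_nat m)\<^sup>2) *
      (\<Prod>j\<in>odds N - {m}. (0 - (of_nat j)\<^sup>2) / ((of_nat m)\<^sup>2 - (of_nat j)\<^sup>2)))"
    by (intro lagrange_interpolation) simp_all
  also have "\<dots> = (\<Sum>m\<in>odds N. of_nat N * F * weight N m)"
  proof (intro sum.cong refl)
    fix m assume m: "m \<in> odds N"
    have "(\<Prod>i\<in>{1..<N}. (of_nat i)\<^sup>2 - (of_nat m)\<^sup>2) = (\<Prod>i\<in>{1..<N}. (of_nat i)\<^sup>2 * (1 - (of_nat m / of_nat i :: rat)\<^sup>2))"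
      by (intro prod.cong refl) (simp add: field_simps)
    also have "\<dots> = F * (\<Prod>i\<in>{1..<N}. 1 - (of_nat m / of_nat i)\<^sup>2)"
      by (simp add: prod.distrib F_def)
    finally have 1: "(\<Prod>i\<in>{1..<N}. (of_nat i)\<^sup>2 - (of_nat m :: rat)\<^sup>2) = F * (\<Prod>i\<in>{1..<N}. 1 - (of_nat m / of_nat i)\<^sup>2)" .
    have "(\<Prod>j\<in>odds N - {m}. (0 - (of_nat j)\<^sup>2) / ((of_nat m)\<^sup>2 - (of_nat j)\<^sup>2)) = (\<Prod>j\<in>odds N - {m}. 1 / (1 - (of_nat m / of_nat j :: rat)\<^sup>2))"
    proof (intro prod.cong refl)
      fix j assume j: "j \<in> odds N - {m}"
      have "of_nat j \<noteq> (0 :: rat)" using j unfolding of_nat_eq_0_iff by (auto simp: odds_def dest: odd_pos)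
      moreover have "(of_nat m :: rat)\<^sup>2 \<noteq> (of_nat j)\<^sup>2" using j by (simp add: power2_eq_iff_nonneg)
      ultimately show "(0 - (of_nat j)\<^sup>2) / ((of_nat m)\<^sup>2 - (of_nat j)\<^sup>2) = 1 / (1 - (of_nat m / of_nat j :: rat)\<^sup>2)"
        by (simp add: divide_simps) (simp add: algebra_simps)
    qed
    also have "\<dots> = 1 / (\<Prod>j\<in>odds N - {m}. 1 - (of_nat m / of_nat j)\<^sup>2)" by (simp add: prod_dividef)
    finally show "poly (trunc_poly N) ((of_nat m)\<^sup>2) *
      (\<Prod>j\<in>odds N - {m}. (0 - (of_nat j)\<^sup>2) / ((of_nat m)\<^sup>2 - (of_nat j)\<^sup>2)) = of_nat N * F * weight N m"
      unfolding poly_trunc_poly_odd[OF m] 1 weight_def using assms by simp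
  qed
  finally show ?thesis
    unfolding poly_trunc_poly_0 F_def[symmetric] sum_distrib_left[symmetric] using F assms by simp
qed

section \<open>Absolute values of the weights in terms of binomial coefficients\<close>

section \<open>Closed form of the weights\<close>

text \<open>The factors m - i and m + i run through the integers from m - n to m + n, except
  m.\<close>

lemma prod_square_diff:
  assumes "n < m"
  shows "(\<Prod>i\<in>{1..n}. (of_nat m)\<^sup>2 - (of_nat i)\<^sup>2) = (fact (m + n) / (of_nat m * fact (m - 1 - n)) :: rat)"
  using assms
proof (induction n)
  case 0
  then show ?case by (simp add: fact_reduce[of m])
next
  case (Suc n)
  obtain d where d: "m = n + d + 2" using Suc.prems less_iff_Suc_add[of "Suc n" m] by auto
  define x y :: rat where "x = of_nat n" and "y = of_nat d"
  have e: "m - 1 - n = Suc d" "m - 1 - Suc n = d" "m + Suc n = Suc (m + n)" using d by auto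
  have mx: "of_nat m = x + y + 2" by (simp add: d x_def y_def)
  define A B :: rat where "A = fact (m + n)" and "B = fact d"
  have f: "fact (Suc d) = (y + 1) * B" "fact (Suc (m + n)) = (x + y + 2 + x + 1) * A"
    unfolding fact_Suc of_nat_Suc of_nat_add A_def B_def x_def[symmetric] y_def[symmetric] mx by algebra+
  have nz: "y + 1 \<noteq> 0" "B \<noteq> 0" "x + y + 2 \<noteq> 0" "x \<ge> 0" "y \<ge> 0"
    by (simp_all add: x_def y_def B_def add_nonneg_eq_0_iff add_eq_0_iff_both_eq_0)
  have "(\<Prod>i\<in>{1..Suc n}. (of_nat m)\<^sup>2 - (of_nat i)\<^sup>2) = A / ((x + y + 2) * ((y + 1) * B)) * ((x + y + 2)\<^sup>2 - (x + 1)\<^sup>2)"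
  proof -
    have "(\<Prod>i\<in>{1..n}. (of_nat m)\<^sup>2 - (of_nat i)\<^sup>2) = A / ((x + y + 2) * ((y + 1) * B))"
      using Suc unfolding e f A_def mx[symmetric] by simp
    moreover have "(of_nat (Suc n))\<^sup>2 = (x + 1)\<^sup>2" by (simp add: x_def add.commute)
    ultimately show ?thesis by (simp add: mx)
  qed
  also have "\<dots> = (x + y + 2 + x + 1) * A / ((x + y + 2) * B)"
    using nz by (simp add: divide_simps power2_eq_square) (simp add: algebra_simps)
  finally show ?case unfolding e f A_def B_def mx .
qed

text \<open>The factors run through the integers from l - k + 1 to l + k.\<close>

lemma prod_triangle:
  assumes "k \<le> l"
  shows "(\<Prod>t<k. (of_nat l - of_nat t) * (of_nat t + of_nat l + 1)) = (fact (l + k) / fact (l - k) :: rat)"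
  using assms
proof (induction k)
  case 0
  then show ?case by simp
next
  case (Suc k)
  obtain d where d: "l = k + d + 1" using Suc.prems less_iff_Suc_add[of k l] by auto
  have e: "l - k = Suc d" "l - Suc k = d" "l + Suc k = Suc (l + k)" using d by auto
  define z B :: rat where "z = of_nat (Suc d)" and "B = fact d"
  have z: "of_nat l - of_nat k = z" "fact (Suc d) = z * B" by (simp_all add: d z_def B_def)
  have nz: "z \<noteq> 0" "B \<noteq> 0" unfolding z_def B_def of_nat_eq_0_iff by simp_all
  have "(\<Prod>t<Suc k. (of_nat l - of_nat t) * (of_nat t + of_nat l + 1))
      = (\<Prod>t<k. (of_nat l - of_nat t) * (of_nat t + of_nat l + 1)) * (z * (of_nat k + of_nat l + 1))"
    by (simp add: z)
  also have "\<dots> = fact (l + k) / (z * B) * (z * (of_nat k + of_nat l + 1))"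
    using Suc unfolding e z by simp
  also have "\<dots> = fact (Suc (l + k)) / B" using nz by (simp add: add_ac mult_ac)
  finally show ?case unfolding e B_def .
qed

text \<open>The factors \<open>\<bar>t - l\<bar>\<close> give l! (N-1-l)!, and the factors t + l + 1
  give (N+l)!/l! without the one at t = l, which is 2l + 1. The induction effectively starts at N =
  l + 1, settled by \<open>prod_triangle\<close>.\<close>

lemma prod_abs_triangle:
  assumes "l < N"
  shows "(\<Prod>t\<in>{..<N}-{l}. \<bar>of_nat t - of_nat l\<bar> * (of_nat t + of_nat l + 1))
    = (fact (N + l) * fact (N - 1 - l) / (2 * of_nat l + 1) :: rat)"
  using assms
proof (induction N)
  case 0
  then show ?case by simp
next
  case (Suc N)
  show ?case
  proof (cases "l = N")
    case True
    have "{..<Suc N} - {l} = {..<l}" using True by auto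
    moreover have "(\<Prod>t<l. \<bar>of_nat t - of_nat l\<bar> * (of_nat t + of_nat l + 1)) = (\<Prod>t<l. (of_nat l - of_nat t) * (of_nat t + of_nat l + 1 :: rat))"
      by (intro prod.cong refl) auto
    moreover have "2 * of_nat l + (1 :: rat) \<noteq> 0" by (simp add: add_nonneg_eq_0_iff)
    ultimately show ?thesis using prod_triangle[of l l]
      by (simp add: True[symmetric] eq_divide_eq mult.commute add.commute)
  next
    case False
    then have l: "l < N" using Suc by simp
    have *: "{..<Suc N} - {l} = insert N ({..<N} - {l})" using False by auto
    obtain d where d: "N = l + d + 1" using l less_iff_Suc_add[of l N] by auto
    have e: "N - 1 - l = d" "Suc N - 1 - l = Suc d" "Suc N + l = Suc (N + l)" using d by auto
    have a: "\<bar>of_nat N - of_nat l :: rat\<bar> = of_nat (Suc d)" by (simp add: d)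
    have f: "fact (Suc d) = of_nat (Suc d) * (fact d :: rat)" "fact (Suc (N + l)) = (of_nat N + of_nat l + 1) * (fact (N + l) :: rat)"
      by (simp_all add: algebra_simps)
    have "(\<Prod>t\<in>insert N ({..<N} - {l}). \<bar>of_nat t - of_nat l\<bar> * (of_nat t + of_nat l + 1))
      = of_nat (Suc d) * (of_nat N + of_nat l + 1) * (fact (N + l) * fact d / (2 * of_nat l + 1 :: rat))"
      by (subst prod.insert) (use Suc.IH[OF l] in \<open>simp_all only: a e\<close>, simp_all)
    then show ?thesis unfolding * e f by (simp only: times_divide_eq_left times_divide_eq_right mult_ac)
  qed
qed

text \<open>The double factorial (2N-1)!!.\<close>

lemma prod_odds: "(\<Prod>j\<in>odds N. of_nat j) = (fact (2 * N) / (2 ^ N * fact N) :: rat)"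
proof -
  have "(\<Prod>j\<in>odds N. of_nat j) = (\<Prod>l<N. of_nat (2 * l + 1) :: rat)"
    unfolding odds_eq_image by (subst prod.reindex) (auto simp: inj_on_def)
  also have "\<dots> = fact (2 * N) / (2 ^ N * fact N)"
  proof (induction N)
    case (Suc N)
    define A B x P :: rat where "A = fact (2 * N)" and "B = fact N" and "x = of_nat N" and "P = (\<Prod>l<N. of_nat (2 * l + 1))"
    have f: "fact (2 * Suc N) = (2 * x + 2) * (2 * x + 1) * A" "fact (Suc N) = (x + 1) * B"
      unfolding mult_Suc_right add_2_eq_Suc fact_Suc of_nat_Suc of_nat_mult of_nat_numeral A_def B_def x_def by algebra+
    have nz: "x + 1 \<noteq> 0" "B \<noteq> 0" by (simp_all add: x_def B_def add_nonneg_eq_0_iff)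
    have "(\<Prod>l<Suc N. of_nat (2 * l + 1)) = A / (2 ^ N * B) * (2 * x + 1)"
      using Suc by (simp add: A_def x_def B_def add.commute)
    also have "\<dots> = (2 * x + 2) * (2 * x + 1) * A / (2 ^ Suc N * ((x + 1) * B))"
      using nz by (simp add: divide_simps)
    finally show ?case unfolding f .
  qed simp
  finally show ?thesis .
qed

text \<open>With j = 2t + 1, j^2 - m^2 = 4(t-l)(t+l+1), which reduces the product to
  \<open>prod_abs_triangle\<close>.\<close>

lemma prod_odds_minus:
  assumes "l < N" and m: "m = 2 * l + 1"
  shows "(\<Prod>j\<in>odds N - {m}. \<bar>(of_nat j)\<^sup>2 - (of_nat m)\<^sup>2\<bar>)
    = (4 ^ (N - 1) * (fact (N + l) * fact (N - 1 - l)) / of_nat m :: rat)"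
proof -
  have "odds N - {m} = (\<lambda>t. 2 * t + 1) ` ({..<N} - {l})"
    unfolding odds_eq_image m by auto
  then have "(\<Prod>j\<in>odds N - {m}. \<bar>(of_nat j)\<^sup>2 - (of_nat m)\<^sup>2\<bar>)
      = (\<Prod>t\<in>{..<N}-{l}. \<bar>(of_nat (2 * t + 1))\<^sup>2 - (of_nat m :: rat)\<^sup>2\<bar>)"
    by (simp add: prod.reindex inj_on_def)
  also have "\<dots> = (\<Prod>t\<in>{..<N}-{l}. 4 * (\<bar>of_nat t - of_nat l\<bar> * (of_nat t + of_nat l + 1)))"
  proof (intro prod.cong refl)
    fix t
    have "(of_nat (2 * t + 1))\<^sup>2 - (of_nat m)\<^sup>2 = 4 * ((of_nat t - of_nat l) * (of_nat t + of_nat l + 1 :: rat))"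
      by (simp add: m power2_eq_square algebra_simps)
    then show "\<bar>(of_nat (2 * t + 1))\<^sup>2 - (of_nat m)\<^sup>2\<bar> = 4 * (\<bar>of_nat t - of_nat l\<bar> * (of_nat t + of_nat l + 1 :: rat))"
      by (simp add: abs_mult)
  qed
  also have "\<dots> = 4 ^ (N - 1) * (fact (N + l) * fact (N - 1 - l)) / of_nat m"
    using assms by (simp add: prod.distrib[of "\<lambda>_. 4"] prod_abs_triangle)
  finally show ?thesis .
qed

text \<open>The binomial coefficients are integers, so apart from a power of 2 only m and m + N can
  remain in the denominator. The sign does not affect integrality, hence the absolute value.\<close>

lemma abs_weight:
  assumes l: "l < N" and m: "m = 2 * l + 1"
  shows "\<bar>weight N m\<bar> * 4 ^ (2 * N - 1) * of_nat m * of_nat (m + N)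
    = 2 * (of_nat N)\<^sup>2 * of_nat ((2 * N choose N)\<^sup>2 * (m + N choose 2 * N) * (2 * N - 1 choose (N + l)))"
proof (cases "m < N")
  case True
  then have "(\<Prod>i\<in>{1..<N}. 1 - (of_nat m / of_nat i :: rat)\<^sup>2) = 0"
    by (intro prod_zero) (auto intro!: bexI[of _ m] simp: m)
  then have "weight N m = 0" unfolding weight_def by (simp only: mult_zero_right div_0)
  moreover have "m + N choose 2 * N = 0" using True by (simp add: binomial_eq_0)
  ultimately show ?thesis by simp
next
  case False
  obtain n where n: "N = Suc n" using l by (cases N) auto
  define x y :: rat where "x = of_nat N" and "y = of_nat m"
  have xy: "x > 0" "y > 0" using l m by (simp_all add: x_def y_def)
  \<comment> \<open>These six factorials suffice: with n = N - 1 both sides become the same quotient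
    in them, x = N and y = m.\<close>
  define F where "F = (fact n :: rat)"
  define G where "G = (fact (2 * n + 1) :: rat)"
  define H where "H = (fact (m + n) :: rat)"
  define K where "K = (fact (m - N) :: rat)"
  define L where "L = (fact (N + l) :: rat)"
  define R where "R = (fact (n - l) :: rat)"
  have pos: "F > 0" "G > 0" "H > 0" "K > 0" "L > 0" "R > 0"
    by (simp_all add: F_def G_def H_def K_def L_def R_def)
  have range: "{1..<N} = {1..n}" using n by auto
  have F2: "(\<Prod>i\<in>{1..n}. (of_nat i :: rat)\<^sup>2) = F\<^sup>2"
    by (simp add: F_def fact_prod prod_power_distrib)
  have "\<bar>\<Prod>i\<in>{1..<N}. 1 - (of_nat m / of_nat i :: rat)\<^sup>2\<bar>
    = (\<Prod>i\<in>{1..n}. ((of_nat m)\<^sup>2 - (of_nat i)\<^sup>2) / (of_nat i)\<^sup>2)"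
    unfolding abs_prod range
  proof (intro prod.cong refl)
    fix i assume i: "i \<in> {1..n}"
    then have "(of_nat i :: rat)\<^sup>2 \<le> (of_nat m)\<^sup>2" using False n by (intro power_mono) auto
    moreover have "1 - (of_nat m / of_nat i :: rat)\<^sup>2 = - (((of_nat m)\<^sup>2 - (of_nat i)\<^sup>2) / (of_nat i)\<^sup>2)"
      using i by (simp add: field_simps)
    ultimately show "\<bar>1 - (of_nat m / of_nat i :: rat)\<^sup>2\<bar> = ((of_nat m)\<^sup>2 - (of_nat i)\<^sup>2) / (of_nat i)\<^sup>2"
      by simp
  qed
  also have "\<dots> = H / (y * K) / F\<^sup>2"
    unfolding prod_dividef F2 using False n by (subst prod_square_diff) (simp_all add: H_def K_def y_def)
  finally have num: "\<bar>\<Prod>i\<in>{1..<N}. 1 - (of_nat m / of_nat i :: rat)\<^sup>2\<bar> = H / (y * K) / F\<^sup>2" .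
  have mN: "m \<in> odds N" using l m by (simp add: odds_def)
  have "(\<Prod>j\<in>odds N. of_nat j) = y * (\<Prod>j\<in>odds N - {m}. of_nat j :: rat)"
    unfolding y_def by (rule prod.remove[OF finite_odds mN])
  moreover have "fact (2 * N) = 2 * x * G" "fact N = x * F" by (simp_all add: n G_def F_def x_def)
  ultimately have J: "(\<Prod>j\<in>odds N - {m}. of_nat j) = 2 * G / (2 ^ N * F * y)"
    using prod_odds[of N] xy pos by (simp add: divide_simps)
  have "\<bar>\<Prod>j\<in>odds N - {m}. 1 - (of_nat m / of_nat j :: rat)\<^sup>2\<bar>
    = (\<Prod>j\<in>odds N - {m}. \<bar>(of_nat j)\<^sup>2 - (of_nat m)\<^sup>2\<bar> / (of_nat j)\<^sup>2)"
    unfolding abs_prod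
  proof (intro prod.cong refl)
    fix j assume "j \<in> odds N - {m}"
    then have "of_nat j \<noteq> (0 :: rat)" unfolding of_nat_eq_0_iff by (auto simp: odds_def dest: odd_pos)
    then have "1 - (of_nat m / of_nat j :: rat)\<^sup>2 = ((of_nat j)\<^sup>2 - (of_nat m)\<^sup>2) / (of_nat j)\<^sup>2"
      by (simp add: field_simps)
    then show "\<bar>1 - (of_nat m / of_nat j :: rat)\<^sup>2\<bar> = \<bar>(of_nat j)\<^sup>2 - (of_nat m)\<^sup>2\<bar> / (of_nat j)\<^sup>2"
      by simp
  qed
  also have "\<dots> = 4 ^ n * (L * R) / y / (2 * G / (2 ^ N * F * y))\<^sup>2"
    unfolding prod_dividef prod_odds_minus[OF l m] prod_power_distrib[symmetric] J by (simp add: n L_def R_def y_def)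
  finally have den: "\<bar>\<Prod>j\<in>odds N - {m}. 1 - (of_nat m / of_nat j :: rat)\<^sup>2\<bar>
    = 4 ^ n * (L * R) / y / (2 * G / (2 ^ N * F * y))\<^sup>2" .
  have p4: "(2 ^ N)\<^sup>2 = 4 * (4 ^ n :: rat)" "4 ^ (2 * N - 1) = 4 * 4 ^ n * (4 ^ n :: rat)"
  proof -
    show "(2 ^ N)\<^sup>2 = 4 * (4 ^ n :: rat)"
      using power_mult_distrib[of "2 :: rat" 2 N] unfolding power2_eq_square by (simp add: n)
    have "2 * N - 1 = 1 + n + n" using n by simp
    then show "4 ^ (2 * N - 1) = 4 * 4 ^ n * (4 ^ n :: rat)" by (simp only: power_add power_one_right)
  qed
  have "\<bar>weight N m\<bar> * 4 ^ (2 * N - 1) * y * (y + x)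
    = y / x * (H / (y * K) / F\<^sup>2) / (4 ^ n * (L * R) / y / (2 * G / (2 ^ N * F * y))\<^sup>2) * 4 ^ (2 * N - 1) * y * (y + x)"
    unfolding weight_def abs_mult abs_divide num den by (simp add: x_def y_def)
  also have "\<dots> = 4 * (y + x) * H * G\<^sup>2 / (x * K * F ^ 4 * L * R)"
    unfolding power_divide power_mult_distrib p4 using xy pos
    by (simp add: field_simps power2_eq_square power4_eq_xxxx)
  finally have lhs: "\<bar>weight N m\<bar> * 4 ^ (2 * N - 1) * y * (y + x) = 4 * (y + x) * H * G\<^sup>2 / (x * K * F ^ 4 * L * R)" .
  have "of_nat (2 * N choose N) = 2 * x * G / (x * F * (x * F))"
    using binomial_fact[of N "2 * N", where ?'a = rat] by (simp add: n G_def F_def x_def)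
  moreover have "of_nat (m + N choose 2 * N) = (y + x) * H / (2 * x * G * K)"
    using binomial_fact[of "2 * N" "m + N", where ?'a = rat] False by (simp add: n G_def H_def K_def x_def y_def)
  moreover have "of_nat (2 * N - 1 choose (N + l)) = G / (L * R)"
    using binomial_fact[of "N + l" "2 * N - 1", where ?'a = rat] l by (simp add: n G_def L_def R_def)
  ultimately have "2 * (of_nat N)\<^sup>2 * of_nat ((2 * N choose N)\<^sup>2 * (m + N choose 2 * N) * (2 * N - 1 choose (N + l)))
    = 2 * x\<^sup>2 * ((2 * x * G / (x * F * (x * F)))\<^sup>2 * ((y + x) * H / (2 * x * G * K)) * (G / (L * R)))"
    by (simp add: x_def)
  also have "\<dots> = 4 * (y + x) * H * G\<^sup>2 / (x * K * F ^ 4 * L * R)"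
    using xy pos by (simp add: field_simps power2_eq_square power4_eq_xxxx)
  finally show ?thesis using lhs by (simp add: x_def y_def)
qed

section \<open>The ring of p-integral rationals and its units congruent to 1\<close>

section \<open>\<open>p\<close>-integral rationals\<close>

text \<open>The fraction need not be reduced, which makes the closure properties immediate.\<close>

definition p_integral :: "nat \<Rightarrow> rat \<Rightarrow> bool" where
  "p_integral p x \<longleftrightarrow> (\<exists>a b. \<not> int p dvd b \<and> x = of_int a / of_int b)"

lemma p_integralI: "\<not> int p dvd b \<Longrightarrow> x = of_int a / of_int b \<Longrightarrow> p_integral p x"
  unfolding p_integral_def by blast

text \<open>The reduced denominator divides every other denominator of the same rational.\<close>

lemma rat_cong_iff_p_integral:
  "rat_cong_mod_prime_pow a b p m \<longleftrightarrow> p_integral p ((a - b) / of_nat p ^ m)"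
proof -
  have "p_integral p x \<longleftrightarrow> \<not> int p dvd snd (quotient_of x)" for x
  proof
    assume "\<not> int p dvd snd (quotient_of x)"
    then show "p_integral p x" by (rule p_integralI) (rule quotient_of_div, rule prod.collapse[symmetric])
  next
    assume "p_integral p x"
    then obtain u v where v: "\<not> int p dvd v" and x: "x = of_int u / of_int v" unfolding p_integral_def by blast
    obtain c d where cd: "quotient_of x = (c, d)" by force
    have "d > 0" "coprime c d" using quotient_of_denom_pos[OF cd] quotient_of_coprime[OF cd] by auto
    moreover have "of_int c / of_int d = (of_int u / of_int v :: rat)" using x quotient_of_div[OF cd] by simp
    moreover have "v \<noteq> 0" using v by auto
    ultimately have "of_int (c * v) = (of_int (u * d) :: rat)" by (simp add: frac_eq_eq)
    then have "c * v = u * d" unfolding of_int_eq_iff .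
    then have "d dvd c * v" by simp
    then have "d dvd v" using \<open>coprime c d\<close> coprime_dvd_mult_right_iff[of d c v] by (simp add: coprime_commute)
    then show "\<not> int p dvd snd (quotient_of x)" using v cd dvd_trans by auto
  qed
  then show ?thesis by (simp add: rat_cong_mod_prime_pow_def)
qed

context
  fixes p :: nat
  assumes p: "prime p"
begin

lemma p_not_dvd_mult: "\<not> int p dvd a \<Longrightarrow> \<not> int p dvd b \<Longrightarrow> \<not> int p dvd a * b"
  using p by (simp add: prime_dvd_mult_iff)

lemma p_integral_of_int: "p_integral p (of_int a)"
  using p by (intro p_integralI[of p 1]) (auto dest: not_prime_unit)

lemma p_integral_of_nat: "p_integral p (of_nat a)"
  using p_integral_of_int[of "int a"] by simp

lemma p_integral_mult: assumes "p_integral p x" "p_integral p y" shows "p_integral p (x * y)"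
proof -
  obtain a b c d where "\<not> int p dvd b" "x = of_int a / of_int b" "\<not> int p dvd d" "y = of_int c / of_int d"
    using assms unfolding p_integral_def by blast
  then show ?thesis by (intro p_integralI[of p "b * d" _ "a * c"] p_not_dvd_mult) auto
qed

lemma p_integral_add: assumes "p_integral p x" "p_integral p y" shows "p_integral p (x + y)"
proof -
  obtain a b c d where *: "\<not> int p dvd b" "x = of_int a / of_int b" "\<not> int p dvd d" "y = of_int c / of_int d"
    using assms unfolding p_integral_def by blast
  moreover have "b \<noteq> 0" "d \<noteq> 0" using * by auto
  ultimately show ?thesis
    by (intro p_integralI[of p "b * d" _ "a * d + c * b"] p_not_dvd_mult) (auto simp: field_simps)
qed

lemma p_integral_minus: "p_integral p x \<Longrightarrow> p_integral p (- x)"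
  using p_integral_mult[OF p_integral_of_int[of "-1"]] by simp

lemma p_integral_abs: "p_integral p \<bar>x\<bar> \<Longrightarrow> p_integral p x"
  using p_integral_minus[of "\<bar>x\<bar>"] by (cases "x \<ge> 0") auto

lemma p_integral_power: "p_integral p x \<Longrightarrow> p_integral p (x ^ n)"
  using p_integral_of_nat[of 1] by (induction n) (auto intro: p_integral_mult)

lemma p_integral_sum: "(\<And>i. i \<in> A \<Longrightarrow> p_integral p (f i)) \<Longrightarrow> p_integral p (\<Sum>i\<in>A. f i)"
  using p_integral_of_nat[of 0] by (induction A rule: infinite_finite_induct) (auto intro: p_integral_add)

lemma p_integral_inverse: "\<not> p dvd n \<Longrightarrow> p_integral p (1 / of_nat n)"
  by (rule p_integralI[of p "int n" _ 1]) auto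

text \<open>(1 + u p^e)(1 + v p^e) = 1 + (u + v + u v p^e) p^e.\<close>

lemma one_unit_mult:
  assumes "p_integral p ((x - 1) / of_nat p ^ e)" "p_integral p ((y - 1) / of_nat p ^ e)"
  shows "p_integral p ((x * y - 1) / of_nat p ^ e)"
proof -
  have p0: "of_nat p \<noteq> (0 :: rat)" using p by auto
  define u v where "u = (x - 1) / of_nat p ^ e" and "v = (y - 1) / of_nat p ^ e"
  have "x = 1 + u * of_nat p ^ e" "y = 1 + v * of_nat p ^ e" using p0 by (simp_all add: u_def v_def)
  then have "(x * y - 1) / of_nat p ^ e = u + v + u * v * of_nat p ^ e"
    using p0 by (simp add: field_simps)
  then show ?thesis using assms p_integral_power[OF p_integral_of_nat]
    by (simp add: u_def[symmetric] v_def[symmetric] p_integral_add p_integral_mult)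
qed

text \<open>If x = 1 + (a/b) p^e, then 1/x - 1 = -a p^e / (b + a p^e), and p does not divide this
  denominator because \<open>e > 0\<close>.\<close>

lemma one_unit_inverse:
  assumes "p_integral p ((x - 1) / of_nat p ^ e)" "e > 0"
  shows "p_integral p ((1 / x - 1) / of_nat p ^ e)"
proof -
  have p0: "of_nat p \<noteq> (0 :: rat)" using p by auto
  obtain a b where b: "\<not> int p dvd b" and ab: "(x - 1) / of_nat p ^ e = of_int a / of_int b"
    using assms unfolding p_integral_def by blast
  have "int p dvd a * int p ^ e" using \<open>e > 0\<close> by (intro dvd_mult) simp
  then have nd: "\<not> int p dvd b + a * int p ^ e" using b dvd_add_left_iff by blast
  have b0: "of_int b \<noteq> (0 :: rat)" using b by auto
  have "b + a * int p ^ e \<noteq> 0" using nd by auto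
  then have c0: "of_int (b + a * int p ^ e) \<noteq> (0 :: rat)" unfolding of_int_eq_0_iff .
  have x: "x = of_int (b + a * int p ^ e) / of_int b" using ab b0 p0 by (simp add: field_simps)
  have "1 / x - 1 = (of_int b - of_int (b + a * int p ^ e)) / of_int (b + a * int p ^ e)"
  proof -
    have "b \<noteq> 0 \<Longrightarrow> c \<noteq> 0 \<Longrightarrow> 1 / (c / b) - 1 = (b - c) / c" for b c :: rat by (simp add: field_simps)
    then show ?thesis unfolding x using b0 c0 by blast
  qed
  also have "\<dots> = - of_int a * of_nat p ^ e / of_int (b + a * int p ^ e)" by simp
  finally have "(1 / x - 1) / of_nat p ^ e = of_int (- a) / of_int (b + a * int p ^ e)"
    using p0 by simp
  then show ?thesis by (intro p_integralI[OF nd])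
qed

lemma one_unit_prod:
  "(\<And>i. i \<in> A \<Longrightarrow> p_integral p ((f i - 1) / of_nat p ^ e)) \<Longrightarrow> p_integral p (((\<Prod>i\<in>A. f i) - 1) / of_nat p ^ e)"
  using p_integral_of_nat[of 0]
  by (induction A rule: infinite_finite_induct) (auto intro: one_unit_mult)

text \<open>The hypothesis bounds the multiplicity of p in n by s - 1, so p n contains at most s
  factors p.\<close>

lemma p_integral_prime_power_div:
  assumes "\<not> p ^ s dvd n"
  shows "p_integral p (of_nat (p ^ s) / of_nat (p * n))"
proof -
  have n0: "n \<noteq> 0" using assms by (metis dvd_0_right)
  have "\<not> is_unit p" using p not_prime_unit by blast
  then obtain u where u: "n = p ^ multiplicity p n * u" "\<not> p dvd u"
    using multiplicity_decompose'[OF n0] by blast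
  have "multiplicity p n < s" using assms by (metis multiplicity_dvd' not_less)
  then obtain d where d: "s = Suc (multiplicity p n + d)" using less_iff_Suc_add by auto
  have "of_nat p \<noteq> (0 :: rat)" "of_nat u \<noteq> (0 :: rat)"
    using p u(2) unfolding of_nat_eq_0_iff by (metis dvd_0_right not_prime_0)+
  then have "of_nat (p ^ s) / of_nat (p * n) = of_nat (p ^ d) * (1 / of_nat u :: rat)"
    by (subst u(1), subst d) (simp add: power_add)
  then show ?thesis by (simp only:) (intro p_integral_mult p_integral_of_nat p_integral_inverse u(2))
qed

end

section \<open>Separating the multiples of q, and the congruences between weights\<close>

section \<open>Comparison of the weights\<close>

context
  fixes q :: nat and A B :: "nat set"
  assumes q: "q > 0" and fin: "finite A" and multiples: "\<And>k. q * k \<in> A \<longleftrightarrow> k \<in> B"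
begin

text \<open>By the assumption on \<open>A\<close> and \<open>B\<close>, the multiples of q in
  \<open>A\<close> are exactly the q k with k in \<open>B\<close>.\<close>

lemma multiples_split: "A = (*) q ` B \<union> {i\<in>A. \<not> q dvd i}" "(*) q ` B \<inter> {i\<in>A. \<not> q dvd i} = {}"
  "finite ((*) q ` B)" "inj_on ((*) q) B"
proof -
  show *: "A = (*) q ` B \<union> {i\<in>A. \<not> q dvd i}" using multiples by (auto elim!: dvdE)
  show "finite ((*) q ` B)" by (rule finite_subset[OF _ fin]) (use * in blast)
qed (use q in \<open>auto simp: inj_on_def\<close>)

lemma prod_multiples_split:
  "(\<Prod>i\<in>A. f i) = (\<Prod>k\<in>B. f (q * k)) * (\<Prod>i\<in>{i\<in>A. \<not> q dvd i}. f i :: 'a :: comm_monoid_mult)"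
proof -
  have "(\<Prod>i\<in>A. f i) = (\<Prod>i\<in>(*) q ` B. f i) * (\<Prod>i\<in>{i\<in>A. \<not> q dvd i}. f i)"
    by (subst multiples_split(1), rule prod.union_disjoint) (use fin multiples_split in auto)
  then show ?thesis by (simp add: prod.reindex[OF multiples_split(4)])
qed

lemma sum_multiples_split:
  "(\<Sum>i\<in>A. f i) = (\<Sum>k\<in>B. f (q * k)) + (\<Sum>i\<in>{i\<in>A. \<not> q dvd i}. f i :: 'a :: comm_monoid_add)"
proof -
  have "(\<Sum>i\<in>A. f i) = (\<Sum>i\<in>(*) q ` B. f i) + (\<Sum>i\<in>{i\<in>A. \<not> q dvd i}. f i)"
    by (subst multiples_split(1), rule sum.union_disjoint) (use fin multiples_split in auto)
  then show ?thesis by (simp add: sum.reindex[OF multiples_split(4)])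
qed

end

lemma mult_mem_odds_iff: "odd q \<Longrightarrow> q * k \<in> odds (p * q) \<longleftrightarrow> k \<in> odds p"
  by (auto simp: odds_def odd_pos)

text \<open>Homogeneity: in the factors with q | i or q | j the common factor q cancels, and these
  factors form \<open>weight p \<mu>\<close>.\<close>

lemma weight_scale:
  assumes q: "odd q" and N: "N = p * q"
  shows "weight N (q * \<mu>) = weight p \<mu> *
    ((\<Prod>i\<in>{i\<in>{1..<N}. \<not> q dvd i}. 1 - (of_nat (q * \<mu>) / of_nat i)\<^sup>2)
      * (1 / (\<Prod>j\<in>{j\<in>odds N. \<not> q dvd j}. 1 - (of_nat (q * \<mu>) / of_nat j)\<^sup>2)))"
proof -
  have q0: "q > 0" using q by (simp add: odd_pos)
  have red: "of_nat (q * \<mu>) / of_nat (q * i) = (of_nat \<mu> / of_nat i :: rat)" for i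
    using q0 by simp
  have A: "(\<Prod>i\<in>{1..<N}. 1 - (of_nat (q * \<mu>) / of_nat i)\<^sup>2) =
      (\<Prod>i\<in>{1..<p}. 1 - (of_nat \<mu> / of_nat i)\<^sup>2) *
      (\<Prod>i\<in>{i\<in>{1..<N}. \<not> q dvd i}. 1 - (of_nat (q * \<mu>) / of_nat i :: rat)\<^sup>2)"
    unfolding red[symmetric] by (rule prod_multiples_split) (use q0 in \<open>auto simp: N Suc_le_eq\<close>)
  \<comment> \<open>The excluded node is a multiple of q, so its exclusion concerns only the factors
    with q | j.\<close>
  have "{j\<in>odds N - {q * \<mu>}. \<not> q dvd j} = {j\<in>odds N. \<not> q dvd j}" by auto
  then have B: "(\<Prod>j\<in>odds N - {q * \<mu>}. 1 - (of_nat (q * \<mu>) / of_nat j)\<^sup>2) =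
      (\<Prod>j\<in>odds p - {\<mu>}. 1 - (of_nat \<mu> / of_nat j)\<^sup>2) *
      (\<Prod>j\<in>{j\<in>odds N. \<not> q dvd j}. 1 - (of_nat (q * \<mu>) / of_nat j :: rat)\<^sup>2)"
    unfolding red[symmetric] using q0 mult_mem_odds_iff[OF q, of _ p] N
    by (subst prod_multiples_split[where q = q and B = "odds p - {\<mu>}"]) simp_all
  have C: "of_nat (q * \<mu>) / of_nat N = (of_nat \<mu> / of_nat p :: rat)" using q0 by (simp add: N)
  show ?thesis unfolding weight_def A B C
    by (simp only: times_divide_eq_left times_divide_eq_right divide_divide_eq_left mult_1_right mult_ac)
qed

context
  fixes p s q N :: nat
  assumes p: "prime p" and odd: "odd p"
  defines "q \<equiv> p ^ s"
  defines "N \<equiv> p * q"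
begin

text \<open>Every factor left over by \<open>weight_scale\<close> is 1 modulo p^e, hence so is their
  quotient. The exponent is left open: e = 4 serves for \<open>\<mu> = p\<close> and e = 2 for the
  others.\<close>

lemma weight_scale_cong:
  assumes e: "p_integral p ((of_nat \<mu>)\<^sup>2 * of_nat p ^ 2 / of_nat p ^ e)" "e > 0"
  shows "\<exists>Q. weight N (q * \<mu>) = weight p \<mu> * Q \<and> p_integral p ((Q - 1) / of_nat p ^ e)"
proof -
  have p0: "of_nat p \<noteq> (0 :: rat)" using p by auto
  have unit: "p_integral p ((1 - (of_nat (q * \<mu>) / of_nat i)\<^sup>2 - 1) / of_nat p ^ e)" if "\<not> q dvd i" for i
  proof -
    have "i > 0" using that by (cases i) auto
    \<comment> \<open>Writing q/i as p times q/(p i) isolates a p-integral factor, since q does not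
      divide i.\<close>
    then have eq: "(1 - (of_nat (q * \<mu>) / of_nat i)\<^sup>2 - 1) / of_nat p ^ e =
      - (((of_nat \<mu>)\<^sup>2 * of_nat p ^ 2 / of_nat p ^ e) * (of_nat (p ^ s) / of_nat (p * i) :: rat)\<^sup>2)"
      using p0 by (simp add: q_def power_mult_distrib power_divide mult_ac)
    show ?thesis unfolding eq
      by (intro p_integral_minus p_integral_mult p_integral_power p_integral_prime_power_div p e(1)) (use that in \<open>simp add: q_def\<close>)
  qed
  define U where "U = (\<Prod>i\<in>{i\<in>{1..<N}. \<not> q dvd i}. 1 - (of_nat (q * \<mu>) / of_nat i :: rat)\<^sup>2)"
  define V where "V = (\<Prod>j\<in>{j\<in>odds N. \<not> q dvd j}. 1 - (of_nat (q * \<mu>) / of_nat j :: rat)\<^sup>2)"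
  have "p_integral p ((U - 1) / of_nat p ^ e)" "p_integral p ((V - 1) / of_nat p ^ e)"
    unfolding U_def V_def by (intro one_unit_prod[OF p] unit; simp)+
  then have "p_integral p ((U * (1 / V) - 1) / of_nat p ^ e)"
    by (intro one_unit_mult[OF p] one_unit_inverse[OF p] e(2))
  moreover have "weight N (q * \<mu>) = weight p \<mu> * (U * (1 / V))"
    unfolding U_def V_def using odd by (intro weight_scale) (simp_all add: q_def N_def)
  ultimately show ?thesis by blast
qed

text \<open>By \<open>abs_weight\<close> the weight is a p-integral multiple of M^2/(m(m+M)), the
  power of 4 being prime to the odd p.\<close>

lemma p_integral_weight:
  assumes m: "m \<in> odds M" and c: "p_integral p (c * (of_nat M)\<^sup>2 / (of_nat m * of_nat (m + M)))"
  shows "p_integral p (c * weight M m)"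
proof -
  obtain l where l: "l < M" "m = 2 * l + 1" using m by (auto simp: odds_eq_image)
  define B where "B = (2 * M choose M)\<^sup>2 * (m + M choose 2 * M) * (2 * M - 1 choose (M + l))"
  have nz: "of_nat m \<noteq> (0 :: rat)" "of_nat (m + M) \<noteq> (0 :: rat)"
    unfolding of_nat_eq_0_iff using l by auto
  have "\<bar>weight M m\<bar> = 2 * of_nat B * (1 / of_nat (4 ^ (2 * M - 1))) * ((of_nat M)\<^sup>2 / (of_nat m * of_nat (m + M)))"
  proof -
    define c X :: rat where "c = of_nat m * of_nat (m + M)" and "X = 4 ^ (2 * M - 1)"
    have "c \<noteq> 0" "X \<noteq> 0" using nz by (simp_all add: c_def X_def del: of_nat_add)
    moreover have "\<bar>weight M m\<bar> * X * c = 2 * (of_nat M)\<^sup>2 * of_nat B"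
      using abs_weight[OF l] unfolding B_def[symmetric] c_def X_def by (simp only: mult.assoc)
    moreover have "of_nat (4 ^ (2 * M - 1)) = X" by (simp add: X_def)
    ultimately show ?thesis unfolding c_def[symmetric] by (simp add: field_simps)
  qed
  then have "\<bar>c * weight M m\<bar> = of_nat (2 * B) * (1 / of_nat (4 ^ (2 * M - 1))) * \<bar>c * (of_nat M)\<^sup>2 / (of_nat m * of_nat (m + M))\<bar>"
    by (simp add: abs_mult)
  moreover have "\<not> p dvd 4 ^ (2 * M - 1)"
  proof
    assume "p dvd 4 ^ (2 * M - 1)"
    then have "p dvd 2 * 2" using prime_dvd_power[OF p] by fastforce
    then have "p dvd 2" using prime_dvd_mult_nat[OF p] by blast
    then show False using p odd by (metis primes_dvd_imp_eq two_is_prime_nat dvd_refl)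
  qed
  moreover have "p_integral p \<bar>c * (of_nat M)\<^sup>2 / (of_nat m * of_nat (m + M))\<bar>"
    using c p_integral_minus[OF p c] by (simp add: abs_if)
  ultimately have "p_integral p \<bar>c * weight M m\<bar>"
    by (simp only:) (intro p_integral_mult p p_integral_of_nat p_integral_inverse)
  then show ?thesis by (rule p_integral_abs[OF p])
qed

text \<open>N^2/(p^4 m(m+N)) is the product of q/(p m) and q/(p(m+N)). Both are p-integral, since q
  divides N and hence not m + N.\<close>

lemma weight_vanish:
  assumes m: "m \<in> odds N" and q: "\<not> q dvd m"
  shows "p_integral p (weight N m / of_nat p ^ 4)"
proof -
  have p0: "of_nat p \<noteq> (0 :: rat)" using p by auto
  have "\<not> q dvd m + N" using q by (simp add: N_def)
  moreover have "m > 0" using m by (simp add: odds_def odd_pos)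
  ultimately have "p_integral p (of_nat (p ^ s) / of_nat (p * m) * (of_nat (p ^ s) / of_nat (p * (m + N))))"
    using q unfolding q_def by (intro p_integral_mult p p_integral_prime_power_div)
  also have "of_nat (p ^ s) / of_nat (p * m) * (of_nat (p ^ s) / of_nat (p * (m + N)))
     = (1 / of_nat p ^ 4) * (of_nat N)\<^sup>2 / (of_nat m * of_nat (m + N) :: rat)"
    using p0 \<open>m > 0\<close> by (simp add: N_def q_def power_mult_distrib power2_eq_square power4_eq_xxxx del: of_nat_add)
  finally show ?thesis using p_integral_weight[OF m, of "1 / of_nat p ^ 4"] by simp
qed

text \<open>The difference is \<open>weight p \<mu>\<close> times Q - 1. For
  \<open>\<mu> = p\<close> the second factor supplies all of p^4; otherwise each factor supplies
  p^2.\<close>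

lemma weight_cong:
  assumes \<mu>: "\<mu> \<in> odds p"
  shows "p_integral p ((weight N (q * \<mu>) - weight p \<mu>) / of_nat p ^ 4)"
proof (cases "\<mu> = p")
  case True
  have p0: "of_nat p \<noteq> (0 :: rat)" using p by auto
  have "p_integral p ((of_nat \<mu>)\<^sup>2 * of_nat p ^ 2 / of_nat p ^ 4)"
    using p0 p_integral_of_nat[OF p, of 1] by (simp add: True power2_eq_square power4_eq_xxxx)
  then obtain Q where Q: "weight N (q * \<mu>) = weight p \<mu> * Q" "p_integral p ((Q - 1) / of_nat p ^ 4)"
    using weight_scale_cong[of \<mu> 4] by auto
  have "\<not> p dvd 2" using p odd by (metis primes_dvd_imp_eq two_is_prime_nat dvd_refl)
  \<comment> \<open>For \<open>\<mu> = p\<close> this fraction is 1/2.\<close>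
  then have "p_integral p (1 * (of_nat p)\<^sup>2 / (of_nat \<mu> * of_nat (\<mu> + p)))"
    using p0 p_integral_inverse[OF p, of 2] by (simp add: True power2_eq_square field_simps)
  then have "p_integral p (weight p \<mu>)" using p_integral_weight[OF \<mu>, of 1] by simp
  then have "p_integral p (weight p \<mu> * ((Q - 1) / of_nat p ^ 4))" using Q(2) by (rule p_integral_mult[OF p])
  also have "weight p \<mu> * ((Q - 1) / of_nat p ^ 4) = (weight N (q * \<mu>) - weight p \<mu>) / of_nat p ^ 4"
    unfolding Q(1) by (simp add: algebra_simps)
  finally show ?thesis .
next
  case False
  have p0: "of_nat p \<noteq> (0 :: rat)" using p by auto
  \<comment> \<open>The only odd multiple of p below 2p is p itself.\<close>
  have nd: "\<not> p dvd \<mu>"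
  proof
    assume "p dvd \<mu>"
    then obtain k where k: "\<mu> = p * k" by blast
    then have "k < 2" "odd k" using \<mu> by (auto simp: odds_def)
    then have "k = 1" by (cases k) auto
    with k False show False by simp
  qed
  have "p_integral p ((of_nat \<mu>)\<^sup>2 * of_nat p ^ 2 / of_nat p ^ 2)"
    using p0 p_integral_of_nat[OF p, of "\<mu>\<^sup>2"] by simp
  then obtain Q where Q: "weight N (q * \<mu>) = weight p \<mu> * Q" "p_integral p ((Q - 1) / of_nat p ^ 2)"
    using weight_scale_cong[of \<mu> 2] by auto
  have "\<not> p dvd \<mu> + p" using nd by simp
  then have "p_integral p (1 / of_nat \<mu> * (1 / of_nat (\<mu> + p)))"
    using nd by (intro p_integral_mult p p_integral_inverse)
  then have "p_integral p (1 / (of_nat p)\<^sup>2 * (of_nat p)\<^sup>2 / (of_nat \<mu> * of_nat (\<mu> + p)))"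
    using p0 by simp
  then have "p_integral p (1 / (of_nat p)\<^sup>2 * weight p \<mu>)" by (rule p_integral_weight[OF \<mu>])
  then have "p_integral p (1 / (of_nat p)\<^sup>2 * weight p \<mu> * ((Q - 1) / of_nat p ^ 2))" using Q(2) by (rule p_integral_mult[OF p])
  also have "1 / (of_nat p)\<^sup>2 * weight p \<mu> * ((Q - 1) / of_nat p ^ 2) = (weight N (q * \<mu>) - weight p \<mu>) / of_nat p ^ 4"
    unfolding Q(1) by (simp add: power2_eq_square power4_eq_xxxx field_simps)
  finally show ?thesis .
qed

text \<open>The nodes divisible by q are compared one by one with the nodes for p; the others
  contribute 0 modulo p^4.\<close>

lemma S_sum_cong:
  "p_integral p ((S_sum N / of_nat N - S_sum p / of_nat p) / of_nat p ^ 4)"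
proof -
  have q0: "q > 0" and p0: "p > 0" using p by (auto simp: q_def prime_gt_0_nat)
  have qo: "odd q" using odd by (simp add: q_def)
  have "(\<Sum>m\<in>odds N. weight N m) = (\<Sum>\<mu>\<in>odds p. weight N (q * \<mu>)) + (\<Sum>m\<in>{m\<in>odds N. \<not> q dvd m}. weight N m)"
    using q0 mult_mem_odds_iff[OF qo, of _ p] by (intro sum_multiples_split) (simp_all add: N_def)
  moreover have "N > 0" using p0 q0 by (simp add: N_def)
  ultimately have "S_sum N / of_nat N - S_sum p / of_nat p
    = (\<Sum>\<mu>\<in>odds p. weight N (q * \<mu>) - weight p \<mu>) + (\<Sum>m\<in>{m\<in>odds N. \<not> q dvd m}. weight N m)"
    using p0 by (simp add: S_sum_eq_sum_weight sum_subtractf)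
  then have "(S_sum N / of_nat N - S_sum p / of_nat p) / of_nat p ^ 4
    = (\<Sum>\<mu>\<in>odds p. (weight N (q * \<mu>) - weight p \<mu>) / of_nat p ^ 4)
      + (\<Sum>m\<in>{m\<in>odds N. \<not> q dvd m}. weight N m / of_nat p ^ 4)"
    by (simp only: add_divide_distrib sum_divide_distrib)
  then show ?thesis
    by (simp only:) (intro p_integral_add p p_integral_sum weight_cong weight_vanish; simp)
qed

end

theorem theorem2p1:
  fixes p r :: nat
  assumes "prime p" and "odd p" and "r > 0"
  shows "rat_cong_mod_prime_pow (S_sum (p ^ r) / of_nat (p ^ r)) (S_sum p / of_nat p) p 4"
proof -
  obtain s where "r = Suc s" using assms(3) gr0_conv_Suc by blast
  then show ?thesis using S_sum_cong[OF assms(1,2), of s] by (simp add: rat_cong_iff_p_integral)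
qed

end
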